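(* Let $q$ be an odd prime power. There exists $k\in\mathbb{F}_q$ such that the plane-filling curve $C_k\subset\mathbb{P}^2$ over $\mathbb{F}_q$ defined by $$x^2 (x^q y - x y^q) + y^2 (y^q z - y z^q) + (z^2 + k x^2)(z^q x - z x^q) = 0$$ is smooth at all of its $\mathbb{F}_{q^2}$-points.
   Context: $\mathbb{P}^2$ is the projective plane with homogeneous coordinates $[x:y:z]$. A plane curve $C=\{f=0\}\subset\mathbb{P}^2$, with $f\in\mathbb{F}_q[x,y,z]$ nonzero homogeneous, is called plane-filling if it contains every $\mathbb{F}_q$-point of $\mathbb{P}^2$, i.e. $C(\mathbb{F}_q)=\mathbb{P}^2(\mathbb{F}_q)$. The curve $C$ is singular at a point $P$ (with coordinates in some extension of $\mathbb{F}_q$) if $f$ and all three partial derivatives $\partial f/\partial x,\partial f/\partial y,\partial f/\partial z$ vanish at $P$; it is smooth at a point $P\in C$ if it is not singular there. *)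

theory Defs
  imports
    "HOL-Library.Cardinality"
    "HOL-Computational_Algebra.Polynomial"
    "HOL-Number_Theory.Prime_Powers"
    "Jordan_Normal_Form.Matrix"
begin

section \<open>Polynomials in three variables\<close>

text \<open>
  The ring $F[x,y,z]$ is the iterated polynomial ring $F[x][y][z]$, so \<open>x\<close> is the innermost
  variable and \<open>z\<close> the outermost one: the coefficient of $x^i y^j z^k$ in \<open>f\<close> is
  \<open>coeff (coeff (coeff f k) j) i\<close>.
\<close>

type_synonym 'a poly3 = "'a poly poly poly"

definition Const3 :: "'a::field \<Rightarrow> 'a poly3" where
  "Const3 c = [:[:[:c:]:]:]"

definition X3 :: "'a::field poly3" where
  "X3 = [:[:[:0, 1:]:]:]"

definition Y3 :: "'a::field poly3" where
  "Y3 = [:[:0, 1:]:]"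

definition Z3 :: "'a::field poly3" where
  "Z3 = [:0, 1:]"

fun eval3 :: "'a::field poly3 \<Rightarrow> 'a \<times> 'a \<times> 'a \<Rightarrow> 'a" where
  "eval3 f (x, y, z) = poly (poly (poly f [:[:z:]:]) [:y:]) x"

definition dx :: "'a::field poly3 \<Rightarrow> 'a poly3" where
  "dx = map_poly (map_poly pderiv)"

definition dy :: "'a::field poly3 \<Rightarrow> 'a poly3" where
  "dy = map_poly pderiv"

definition dz :: "'a::field poly3 \<Rightarrow> 'a poly3" where
  "dz = pderiv"

definition homogeneous3 :: "nat \<Rightarrow> 'a::field poly3 \<Rightarrow> bool" where
  "homogeneous3 d f \<longleftrightarrow>
    (\<forall>i j k. coeff (coeff (coeff f k) j) i \<noteq> 0 \<longrightarrow> i + j + k = d)"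

definition base_change3 :: "('a::field \<Rightarrow> 'b::field) \<Rightarrow> 'a poly3 \<Rightarrow> 'b poly3" where
  "base_change3 \<iota> = map_poly (map_poly (map_poly \<iota>))"


section \<open>The projective plane and plane curves\<close>

text \<open>A point is the set of all its homogeneous coordinate triples.\<close>

fun proj_point :: "'a::field \<times> 'a \<times> 'a \<Rightarrow> ('a \<times> 'a \<times> 'a) set" where
  "proj_point (x, y, z) = {(c * x, c * y, c * z) | c. c \<noteq> 0}"

definition proj_plane :: "('a::field \<times> 'a \<times> 'a) set set" where
  "proj_plane = proj_point ` {v. v \<noteq> (0, 0, 0)}"

text \<open>
  For homogeneous \<open>f\<close> the vanishing conditions below do not depend on the choice of the
  coordinates \<open>v\<close> of the point. The points of a curve \<open>f = 0\<close> with coordinates in an extension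
  field are obtained by first applying \<^const>\<open>base_change3\<close> to \<open>f\<close>.
\<close>

definition curve_points :: "'a::field poly3 \<Rightarrow> ('a \<times> 'a \<times> 'a) set set" where
  "curve_points f = {P \<in> proj_plane. \<forall>v\<in>P. eval3 f v = 0}"

definition singular_at :: "'a::field poly3 \<Rightarrow> ('a \<times> 'a \<times> 'a) set \<Rightarrow> bool" where
  "singular_at f P \<longleftrightarrow> (\<forall>v\<in>P. eval3 f v = 0 \<and>
     eval3 (dx f) v = 0 \<and> eval3 (dy f) v = 0 \<and> eval3 (dz f) v = 0)"

definition smooth_at :: "'a::field poly3 \<Rightarrow> ('a \<times> 'a \<times> 'a) set \<Rightarrow> bool" where
  "smooth_at f P \<longleftrightarrow> P \<in> curve_points f \<and> \<not> singular_at f P"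

definition plane_curve :: "'a::field poly3 \<Rightarrow> bool" where
  "plane_curve f \<longleftrightarrow> f \<noteq> 0 \<and> (\<exists>d. homogeneous3 d f)"

definition plane_filling :: "'a::field poly3 \<Rightarrow> bool" where
  "plane_filling f \<longleftrightarrow> plane_curve f \<and> curve_points f = proj_plane"


section \<open>The family of curves\<close>

definition C_poly :: "nat \<Rightarrow> 'a::field \<Rightarrow> 'a poly3" where
  "C_poly q k =
     X3^2 * (X3^q * Y3 - X3 * Y3^q) + Y3^2 * (Y3^q * Z3 - Y3 * Z3^q)
       + (Z3^2 + Const3 k * X3^2) * (Z3^q * X3 - Z3 * X3^q)"

end

theory Submission
  imports Defs "HOL-Number_Theory.Residues" "Subresultants.More_Homomorphisms"
begin

text \<open>
  Write \<open>P = (x, y, z)\<close> for a point over the field with $q^2$ elements and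
  \<open>P' = (x\<^sup>q, y\<^sup>q, z\<^sup>q)\<close> for its conjugate. The curve has the equation
  $x^2 a + y^2 b + (z^2 + k x^2) c = 0$, where $a = x^q y - x y^q$, $b = y^q z - y z^q$ and
  $c = z^q x - z x^q$ are, up to order, the coordinates of the cross product of \<open>P'\<close> and \<open>P\<close>. They all vanish exactly when \<open>P\<close> is rational over the field
  with \<open>q\<close> elements, and conjugation changes their signs.

  Suppose that the curve is singular at \<open>P\<close>. Freeze \<open>a\<close>, \<open>b\<close>, \<open>c\<close> at their values for \<open>P\<close> and consider the
  diagonal quadratic form $Q(u, v, w) = (a + k c) u^2 + b v^2 + c w^2$. The equation of the curve
  says $Q(P) = 0$, and its conjugate says $Q(P') = 0$. Since $q = 0$ in the field, the
  coordinates of \<open>P'\<close> behave as constants under differentiation; hence the gradient of the curve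
  at \<open>P\<close> is the gradient of \<open>Q\<close> plus a vector orthogonal to \<open>P'\<close>, and the singularity makes \<open>P\<close>
  and \<open>P'\<close> orthogonal for \<open>Q\<close>, because $2 \<noteq> 0$. So \<open>Q\<close> vanishes on the whole span of \<open>P\<close> and \<open>P'\<close>.
  A diagonal form whose coefficients are tied in this way to the equation $b u + c v + a w = 0$
  of that span cannot do so unless $a = b = c = 0$ (\<open>minors_vanish_at_singular_point\<close>). Thus a
  singular point is rational, for every value of \<open>k\<close>.

  At a rational singular point the ratio $s = y / x$ is a nonzero element of the field with \<open>q\<close>
  elements such that $k = s^3 - s^{-4}$ (\<open>rational_singular_point\<close>). There are only $q - 1$ such
  values of \<open>s\<close>, so some \<open>k\<close> is not of this form
  (\<open>exists_parameter_avoiding_rational_singularities\<close>), and its curve is smooth.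
\<close>

section \<open>Finite fields\<close>

text \<open>
  Multiplication by a nonzero \<open>x\<close> permutes the nonzero elements, so it leaves their product
  unchanged.
\<close>

lemma finite_field_power_card_eq_self:
  fixes x :: "'a::field"
  assumes "finite (UNIV :: 'a set)"
  shows "x ^ CARD('a) = x"
proof (cases "x = 0")
  case True
  then show ?thesis using assms by (simp add: finite_UNIV_card_ge_0)
next
  case False
  let ?U = "UNIV - {0 :: 'a}"
  have fin: "finite ?U" using assms by simp
  have "bij_betw (\<lambda>y. x * y) ?U ?U"
    by (rule bij_betwI[of _ _ _ "\<lambda>y. y / x"]) (use False in auto)
  then have "prod (\<lambda>y. x * y) ?U = prod (\<lambda>y. y) ?U"
    by (rule prod.reindex_bij_betw[of _ _ _ "\<lambda>y. y"])
  then have "x ^ card ?U * prod (\<lambda>y. y) ?U = prod (\<lambda>y. y) ?U"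
    by (simp add: prod.distrib)
  moreover have "prod (\<lambda>y. y) ?U \<noteq> 0"
    using fin by simp
  ultimately have "x ^ card ?U = 1"
    by simp
  moreover have "CARD('a) = Suc (card ?U)"
    using assms by (intro card.remove) auto
  ultimately show ?thesis
    by (metis mult.right_neutral power_Suc)
qed

text \<open>
  The fields with \<open>q\<close> and with $q^2$ elements are the cases \<open>m = 1\<close> and \<open>m = 2\<close>. In both, \<open>q\<close> is a
  power of the characteristic, so that \<open>q\<close> vanishes in the field and $x \<mapsto> x^q$ is additive.
\<close>

lemma CHAR_of_prime_power_card:
  assumes "primepow q" and "CARD('b::field) = q ^ m" and "m > 0"
  shows "prime CHAR('b)" and "\<exists>n>0. q = CHAR('b) ^ n"
proof -
  obtain p n where p: "prime p" and n: "n > 0" and q: "q = p ^ n"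
    using assms(1) by (auto simp: primepow_def)
  have "CHAR('b) dvd p ^ (n * m)"
    using CHAR_dvd_CARD[where 'a = 'b] assms(2) by (simp add: q power_mult)
  moreover from this have "CHAR('b) > 0"
    using p by (auto intro!: Nat.gr0I)
  then have pr: "prime CHAR('b)"
    by (rule prime_CHAR_semidom)
  ultimately have "CHAR('b) = p"
    using p prime_dvd_power[OF pr] primes_dvd_imp_eq[OF pr p] by simp
  with pr n q show "prime CHAR('b)" and "\<exists>n>0. q = CHAR('b) ^ n"
    by auto
qed

lemma of_nat_prime_power_card_eq_0:
  assumes "primepow q" and "CARD('b::field) = q ^ m" and "m > 0"
  shows "(of_nat q :: 'b) = 0"
proof -
  obtain n where "n > 0" and "q = CHAR('b) ^ n"
    using CHAR_of_prime_power_card(2)[OF assms] by blast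
  then show ?thesis by simp
qed

lemma frobenius_add:
  fixes x y :: "'b::field"
  assumes "primepow q" and "CARD('b) = q ^ m" and "m > 0"
  shows "(x + y) ^ q = x ^ q + y ^ q"
proof -
  obtain n where "q = CHAR('b) ^ n"
    using CHAR_of_prime_power_card(2)[OF assms] by blast
  then show ?thesis
    by (rule freshmans_dream'[OF CHAR_of_prime_power_card(1)[OF assms]])
qed

lemma frobenius_diff:
  fixes x y :: "'b::field"
  assumes "primepow q" and "CARD('b) = q ^ m" and "m > 0"
  shows "(x - y) ^ q = x ^ q - y ^ q"
  using frobenius_add[OF assms, of "x - y" y] by simp

lemma finite_roots_frobenius:
  assumes "q > 1"
  shows "finite {s::'b::field. s ^ q = s}" and "card {s::'b. s ^ q = s} \<le> q"
proof -
  let ?p = "Polynomial.monom 1 q - Polynomial.monom 1 1 :: 'b poly"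
  have deg: "degree ?p = q"
    using assms by (subst diff_conv_add_uminus, subst degree_add_eq_left) (auto simp: degree_monom_eq)
  then have nz: "?p \<noteq> 0" using assms by force
  have roots: "{s. s ^ q = s} = {s. poly ?p s = 0}"
    by (auto simp: poly_monom)
  show "finite {s::'b. s ^ q = s}"
    unfolding roots by (rule poly_roots_finite[OF nz])
  show "card {s::'b. s ^ q = s} \<le> q"
    unfolding roots using card_poly_roots_bound[OF nz] deg by simp
qed

section \<open>Formal calculus in three variables\<close>

text \<open>
  The three partial derivatives act on different levels of the iterated polynomial ring. Being a
  derivation passes from a coefficient ring to the polynomials over it by acting on coefficients,
  so all three obey the usual rules of calculus.
\<close>

locale derivation =
  fixes D :: "'r::comm_ring_1 \<Rightarrow> 'r"
  assumes add: "D (f + g) = D f + D g"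
    and mult: "D (f * g) = D f * g + f * D g"
begin

lemma zero [simp]: "D 0 = 0"
  using add[of 0 0] by simp

lemma one [simp]: "D 1 = 0"
  using mult[of 1 1] by simp

lemma diff: "D (f - g) = D f - D g"
  using add[of "f - g" g] by simp

lemma sum: "D (sum h A) = (\<Sum>i\<in>A. D (h i))"
  by (induction A rule: infinite_finite_induct) (auto simp: add)

lemma power: "D (f ^ n) = of_nat n * f ^ (n - 1) * D f"
proof (induction n)
  case (Suc n)
  then show ?case by (cases n) (auto simp: mult algebra_simps)
qed simp

lemma map_poly: "derivation (map_poly D)"
proof
  fix f g :: "'r poly"
  show "map_poly D (f + g) = map_poly D f + map_poly D g"
    by (rule poly_eqI) (simp add: coeff_map_poly add)
  show "map_poly D (f * g) = map_poly D f * g + f * map_poly D g"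
    by (rule poly_eqI) (simp add: coeff_map_poly coeff_mult sum mult sum.distrib)
qed

end

interpretation pderiv: derivation "pderiv :: 'r::idom poly \<Rightarrow> 'r poly"
  by unfold_locales (auto simp: pderiv_add pderiv_mult)

interpretation dz: derivation "dz :: 'a::field poly3 \<Rightarrow> 'a poly3"
  unfolding dz_def by (rule pderiv.derivation_axioms)

interpretation dy: derivation "dy :: 'a::field poly3 \<Rightarrow> 'a poly3"
  unfolding dy_def by (rule pderiv.map_poly)

interpretation dx: derivation "dx :: 'a::field poly3 \<Rightarrow> 'a poly3"
  unfolding dx_def by (rule derivation.map_poly, rule pderiv.map_poly)

lemma partial_derivatives_of_coordinates:
  "dx X3 = 1" "dx Y3 = 0" "dx Z3 = 0" "dx (Const3 k) = 0"
  "dy X3 = 0" "dy Y3 = 1" "dy Z3 = 0" "dy (Const3 k) = 0"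
  "dz X3 = 0" "dz Y3 = 0" "dz Z3 = 1" "dz (Const3 k) = 0"
  by (simp_all add: dx_def dy_def dz_def X3_def Y3_def Z3_def Const3_def
      Polynomial.map_poly_pCons pderiv_pCons pderiv.map_poly[THEN derivation.one]
      pderiv.map_poly[THEN derivation.map_poly, THEN derivation.one])

lemma eval3_hom:
  "eval3 0 v = 0" "eval3 1 v = 1"
  "eval3 (f + g) v = eval3 f v + eval3 g v"
  "eval3 (f - g) v = eval3 f v - eval3 g v"
  "eval3 (f * g) v = eval3 f v * eval3 g v"
  "eval3 (f ^ n) v = eval3 f v ^ n"
  "eval3 (of_nat n) v = of_nat n"
  by (cases v; simp add: of_nat_poly)+

lemma eval3_coordinates:
  "eval3 X3 (x, y, z) = x" "eval3 Y3 (x, y, z) = y" "eval3 Z3 (x, y, z) = z"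
  "eval3 (Const3 k) (x, y, z) = k"
  by (simp_all add: X3_def Y3_def Z3_def Const3_def)

lemma eval3_C_poly:
  "eval3 (C_poly q k) (x, y, z) = x^2 * (x^q * y - x * y^q) + y^2 * (y^q * z - y * z^q)
     + (z^2 + k * x^2) * (z^q * x - z * x^q)"
  by (simp add: C_poly_def eval3_hom eval3_coordinates del: eval3.simps)

text \<open>The $q$-th powers behave as constants, because \<open>q\<close> vanishes in the field.\<close>

lemma gradient_C_poly:
  fixes k :: "'a::field"
  assumes "(of_nat q :: 'a) = 0"
  shows "eval3 (dx (C_poly q k)) (x, y, z) = 2 * x * (x^q * y - x * y^q) - x^2 * y^q
           + 2 * k * x * (z^q * x - z * x^q) + (z^2 + k * x^2) * z^q" (is ?X)
    and "eval3 (dy (C_poly q k)) (x, y, z) = x^2 * x^q + 2 * y * (y^q * z - y * z^q) - y^2 * z^q"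
      (is ?Y)
    and "eval3 (dz (C_poly q k)) (x, y, z) = y^2 * y^q + 2 * z * (z^q * x - z * x^q)
           - (z^2 + k * x^2) * x^q" (is ?Z)
proof -
  note rules = C_poly_def eval3_hom eval3_coordinates partial_derivatives_of_coordinates assms
  show ?X
    by (simp add: rules dx.add dx.diff dx.mult dx.power del: eval3.simps) (simp add: algebra_simps)
  show ?Y
    by (simp add: rules dy.add dy.diff dy.mult dy.power del: eval3.simps) (simp add: algebra_simps)
  show ?Z
    by (simp add: rules dz.add dz.diff dz.mult dz.power del: eval3.simps) (simp add: algebra_simps)
qed

lemma base_change3_C_poly:
  assumes "field_hom \<iota>"
  shows "base_change3 \<iota> (C_poly q k) = C_poly q (\<iota> k)"
proof -
  interpret h0: field_hom \<iota> by fact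
  interpret h1: map_poly_comm_ring_hom \<iota> ..
  interpret h2: map_poly_comm_ring_hom "map_poly \<iota>" ..
  interpret h3: map_poly_comm_ring_hom "map_poly (map_poly \<iota>)" ..
  have "base_change3 \<iota> X3 = X3" "base_change3 \<iota> Y3 = Y3" "base_change3 \<iota> Z3 = Z3"
    "base_change3 \<iota> (Const3 k) = Const3 (\<iota> k)"
    by (simp_all add: base_change3_def X3_def Y3_def Z3_def Const3_def hom_distribs)
  then show ?thesis
    by (simp add: C_poly_def base_change3_def hom_distribs)
qed

section \<open>Homogeneity\<close>

lemma homogeneous3_add: "homogeneous3 d f \<Longrightarrow> homogeneous3 d g \<Longrightarrow> homogeneous3 d (f + g)"
  unfolding homogeneous3_def by (metis add_cancel_right_left coeff_add)

lemma homogeneous3_diff: "homogeneous3 d f \<Longrightarrow> homogeneous3 d g \<Longrightarrow> homogeneous3 d (f - g)"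
  unfolding homogeneous3_def by (metis coeff_diff diff_zero)

lemma homogeneous3_mult:
  assumes "homogeneous3 d f" and "homogeneous3 e g"
  shows "homogeneous3 (d + e) (f * g)"
  unfolding homogeneous3_def
proof (intro allI impI)
  fix i j k
  let ?coeff = "\<lambda>h k j i. Polynomial.coeff (Polynomial.coeff (Polynomial.coeff h k) j) i"
  assume "?coeff (f * g) k j i \<noteq> 0"
  then have "(\<Sum>c\<le>k. \<Sum>b\<le>j. \<Sum>a\<le>i. ?coeff f c b a * ?coeff g (k - c) (j - b) (i - a)) \<noteq> 0"
    by (simp add: coeff_mult coeff_sum)
  then obtain a b c where le: "c \<le> k" "b \<le> j" "a \<le> i"
    and "?coeff f c b a \<noteq> 0" and "?coeff g (k - c) (j - b) (i - a) \<noteq> 0"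
    by (metis (no_types, lifting) atMost_iff mult_eq_0_iff sum.neutral)
  then have "a + b + c = d" and "(i - a) + (j - b) + (k - c) = e"
    using assms unfolding homogeneous3_def by blast+
  with le show "i + j + k = d + e" by simp
qed

lemma homogeneous3_coordinates:
  "homogeneous3 1 X3" "homogeneous3 1 Y3" "homogeneous3 1 Z3" "homogeneous3 0 (Const3 c)"
  by (auto simp: homogeneous3_def X3_def Y3_def Z3_def Const3_def coeff_pCons
      split: nat.splits)

lemma homogeneous3_power: "homogeneous3 d f \<Longrightarrow> homogeneous3 (n * d) (f ^ n)"
proof (induction n)
  case 0
  then show ?case using homogeneous3_coordinates(4)[of 1] by (simp add: Const3_def)
next
  case (Suc n)
  then show ?case using homogeneous3_mult[of d f "n * d" "f ^ n"] by simp
qed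

lemma homogeneous3_C_poly: "homogeneous3 (q + 3) (C_poly q k)"
proof -
  note coords = homogeneous3_coordinates
  have power: "homogeneous3 n (f ^ n)" if "homogeneous3 1 f" for n and f :: "'a poly3"
    using homogeneous3_power[OF that, of n] by simp
  have minor: "homogeneous3 (q + 1) (f ^ q * g - f * g ^ q)"
    if "homogeneous3 1 f" and "homogeneous3 1 g" for f g :: "'a poly3"
    using homogeneous3_mult[OF power[OF that(1), of q] that(2)]
      homogeneous3_mult[OF that(1) power[OF that(2), of q]]
    by (simp add: homogeneous3_diff)
  have quadric: "homogeneous3 2 (Z3 ^ 2 + Const3 k * X3 ^ 2)"
    using homogeneous3_add[OF power[OF coords(3), of 2]
        homogeneous3_mult[OF coords(4) power[OF coords(1), of 2], of k, unfolded add_0]] .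
  have deg: "2 + (q + 1) = q + 3" by simp
  show ?thesis
    unfolding C_poly_def deg[symmetric]
    by (intro homogeneous3_add homogeneous3_mult power minor quadric coords)
qed

text \<open>
  Over the field with \<open>q\<close> elements $x^q y - x y^q$ and its two analogues are zero at every point.
\<close>

lemma plane_filling_C_poly:
  fixes k :: "'a::field"
  assumes "primepow q" and "CARD('a) = q"
  shows "plane_filling (C_poly q k)"
proof -
  have q: "q > 1" using primepow_gt_Suc_0[OF assms(1)] by simp
  then have "finite (UNIV :: 'a set)" using assms(2) by (auto intro: card_ge_0_finite)
  then have fix_pow: "x ^ q = x" for x :: 'a
    using finite_field_power_card_eq_self[of x] assms(2) by simp
  have "(of_nat q :: 'a) = 0"
    using of_nat_prime_power_card_eq_0[where m = 1 and 'b = 'a] assms by simp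
  \<comment> \<open>The polynomial vanishes as a function, so that it is nonzero has to be read off a derivative.\<close>
  then have "eval3 (dz (C_poly q k)) (0, 1, 0) = 1"
    using q by (simp add: gradient_C_poly del: eval3.simps)
  then have "C_poly q k \<noteq> 0" by (auto simp: eval3_hom simp del: eval3.simps)
  moreover have "eval3 (C_poly q k) v = 0" for v
    by (cases v) (simp add: eval3_C_poly fix_pow del: eval3.simps)
  ultimately show ?thesis
    using homogeneous3_C_poly[of q k]
    by (auto simp: plane_filling_def plane_curve_def curve_points_def simp del: eval3.simps)
qed

section \<open>A conic through a pair of conjugate points\<close>

text \<open>
  By the hypotheses a diagonal quadratic form and its polar form vanish on the span of
  $P = (x, y, z)$ and $P' = (X, Y, Z)$. This span contains the vectors $e_1 = X P - x P'$, $e_2 = Y P - y P'$ and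
  $e_3 = Z P - z P'$, whose coordinates are $0$ and, up to sign, the minors of the pair. The
  conclusions are the values of the polar form at $(e_1, e_2)$ and $(e_1, e_3)$, up to sign, and
  of the quadratic form at $e_1$, $e_2$ and $e_3$.
\<close>

lemma diagonal_form_vanishing_on_line:
  fixes x y z X Y Z :: "'b::comm_ring_1"
  assumes "A * x^2 + B * y^2 + C * z^2 = 0"
    and "A * x * X + B * y * Y + C * z * Z = 0"
    and "A * X^2 + B * Y^2 + C * Z^2 = 0"
  shows "C * (Z * x - z * X) * (Y * z - y * Z) = 0"
    and "B * (X * y - x * Y) * (Y * z - y * Z) = 0"
    and "B * (X * y - x * Y)^2 + C * (Z * x - z * X)^2 = 0"
    and "A * (X * y - x * Y)^2 + C * (Y * z - y * Z)^2 = 0"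
    and "A * (Z * x - z * X)^2 + B * (Y * z - y * Z)^2 = 0"
proof -
  let ?P = "A * x^2 + B * y^2 + C * z^2" and ?R = "A * X^2 + B * Y^2 + C * Z^2"
    and ?M = "A * x * X + B * y * Y + C * z * Z"
  have "C * (Z * x - z * X) * (Y * z - y * Z)
      = - (X * Y * ?P - (X * y + x * Y) * ?M + x * y * ?R)"
    by (simp add: algebra_simps power2_eq_square)
  then show "C * (Z * x - z * X) * (Y * z - y * Z) = 0"
    by (simp add: assms)
  have "B * (X * y - x * Y) * (Y * z - y * Z)
      = - (X * Z * ?P - (X * z + x * Z) * ?M + x * z * ?R)"
    by (simp add: algebra_simps power2_eq_square)
  then show "B * (X * y - x * Y) * (Y * z - y * Z) = 0"
    by (simp add: assms)
  have "B * (X * y - x * Y)^2 + C * (Z * x - z * X)^2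
      = X^2 * ?P - 2 * x * X * ?M + x^2 * ?R"
    by (simp add: algebra_simps power2_eq_square)
  then show "B * (X * y - x * Y)^2 + C * (Z * x - z * X)^2 = 0"
    by (simp add: assms)
  have "A * (X * y - x * Y)^2 + C * (Y * z - y * Z)^2
      = Y^2 * ?P - 2 * y * Y * ?M + y^2 * ?R"
    by (simp add: algebra_simps power2_eq_square)
  then show "A * (X * y - x * Y)^2 + C * (Y * z - y * Z)^2 = 0"
    by (simp add: assms)
  have "A * (Z * x - z * X)^2 + B * (Y * z - y * Z)^2
      = Z^2 * ?P - 2 * z * Z * ?M + z^2 * ?R"
    by (simp add: algebra_simps power2_eq_square)
  then show "A * (Z * x - z * X)^2 + B * (Y * z - y * Z)^2 = 0"
    by (simp add: assms)
qed

text \<open>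
  The conjugate point enters only through its coordinates \<open>X\<close>, \<open>Y\<close>, \<open>Z\<close>, which makes this a
  statement about two vectors over any field of characteristic other than two.
\<close>

lemma minors_vanish_at_singular_point:
  fixes x y z X Y Z k :: "'b::field"
  defines "a \<equiv> X * y - x * Y" and "b \<equiv> Y * z - y * Z" and "c \<equiv> Z * x - z * X"
  assumes two: "(2::'b) \<noteq> 0"
    and curve: "x^2 * a + y^2 * b + (z^2 + k * x^2) * c = 0"
    and conj_curve: "X^2 * a + Y^2 * b + (Z^2 + k * X^2) * c = 0"
    and gradx: "2 * x * a - x^2 * Y + 2 * k * x * c + (z^2 + k * x^2) * Z = 0"
    and grady: "x^2 * X + 2 * y * b - y^2 * Z = 0"
    and gradz: "y^2 * Y + 2 * z * c - (z^2 + k * x^2) * X = 0"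
  shows "a = 0" and "b = 0" and "c = 0"
proof -
  \<comment> \<open>The summands of the gradient other than that of the quadratic form cancel here: they form
    the cross product of $(y^2, z^2 + k x^2, x^2)$ with $(X, Y, Z)$.\<close>
  have "2 * ((a + k * c) * x * X + b * y * Y + c * z * Z)
      = X * (2 * x * a - x^2 * Y + 2 * k * x * c + (z^2 + k * x^2) * Z)
        + Y * (x^2 * X + 2 * y * b - y^2 * Z)
        + Z * (y^2 * Y + 2 * z * c - (z^2 + k * x^2) * X)"
    by (simp add: algebra_simps power2_eq_square)
  also have "\<dots> = 0"
    by (simp only: gradx grady gradz) simp
  finally have "2 * ((a + k * c) * x * X + b * y * Y + c * z * Z) = 0" .
  then have polar: "(a + k * c) * x * X + b * y * Y + c * z * Z = 0"
    using two mult_eq_0_iff by blast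
  have onP: "(a + k * c) * x^2 + b * y^2 + c * z^2 = 0"
    using curve by (simp add: algebra_simps)
  have onQ: "(a + k * c) * X^2 + b * Y^2 + c * Z^2 = 0"
    using conj_curve by (simp add: algebra_simps)
  note line = diagonal_form_vanishing_on_line[OF onP polar onQ, folded a_def b_def c_def]
  have bc: "b = 0 \<or> c = 0" and ab: "a = 0 \<or> b = 0"
    using line(1,2) by auto
  show c: "c = 0"
    using line(3) bc ab by auto
  show b: "b = 0"
    using line(5) c by auto
  show "a = 0"
    using line(4) b c by auto
qed

text \<open>
  Once the minors vanish, the gradient equations force \<open>x\<close> to be nonzero. In the affine
  coordinates $s = y / x$ and $t = z / x$, which the Frobenius map fixes, they become $s^2 t = 1$
  and $s^3 = t^2 + k$.
\<close>

lemma rational_singular_point: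
  fixes x y z k :: "'b::field"
  assumes nz: "(x, y, z) \<noteq> (0, 0, 0)" and q: "q > 0"
    and a: "x^q * y - x * y^q = 0" and c: "z^q * x - z * x^q = 0"
    and gradx: "(z^2 + k * x^2) * z^q = x^2 * y^q"
    and grady: "x^2 * x^q = y^2 * z^q"
    and gradz: "y^2 * y^q = (z^2 + k * x^2) * x^q"
  obtains s where "s \<noteq> 0" and "s^q = s" and "k = s^3 - 1 / s^4"
proof -
  have x: "x \<noteq> 0"
  proof
    assume x: "x = 0"
    with gradx q have "z = 0" by (simp add: zero_power)
    moreover from x gradz q have "y = 0" by (simp add: zero_power)
    ultimately show False using nz x by simp
  qed
  define s t where "s = y / x" and "t = z / x"
  have y: "y = s * x" and z: "z = t * x" using x by (simp_all add: s_def t_def)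
  have s: "s^q = s" using a x by (simp add: y power_mult_distrib)
  have t: "t^q = t" using c x by (simp add: z power_mult_distrib)
  have xq: "x^2 * x^q \<noteq> 0" using x by simp
  have "x^2 * x^q * (s^2 * t - 1) = 0"
    using grady by (simp add: y z power_mult_distrib s t algebra_simps)
  then have st: "s^2 * t = 1" using xq by simp
  have "x^2 * x^q * (s^3 - (t^2 + k)) = 0"
    using gradz by (simp add: y z power_mult_distrib s t algebra_simps power3_eq_cube power2_eq_square)
  then have "s^3 - (t^2 + k) = 0" using xq mult_eq_0_iff by blast
  then have k: "k = s^3 - t^2" by (simp add: algebra_simps)
  from st have s0: "s \<noteq> 0" by auto
  then have "t = 1 / s^2" using st by (simp add: field_simps)
  then have "t^2 = 1 / s^4" by (simp add: power_divide flip: power_mult)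
  with k s0 s that show ?thesis by simp
qed

text \<open>
  The equation $s^q = s$ has at most \<open>q\<close> solutions, one of them zero, so fewer than \<open>q\<close> values of
  the parameter are excluded. Counting in the larger field avoids showing that the solutions come
  from the smaller one.
\<close>

lemma exists_parameter_avoiding_rational_singularities:
  fixes \<iota> :: "'a::field \<Rightarrow> 'b::field"
  assumes "CARD('a) = q" and "q > 1" and "inj \<iota>"
  obtains k where "\<And>s. s \<noteq> 0 \<Longrightarrow> s^q = s \<Longrightarrow> \<iota> k \<noteq> s^3 - 1 / s^4"
proof -
  let ?S = "{s::'b. s^q = s}" and ?g = "\<lambda>s::'b. s^3 - 1 / s^4"
  have fin: "finite ?S" and "card ?S \<le> q"
    using finite_roots_frobenius[OF assms(2)] by auto
  then have "card (?S - {0}) < q"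
    using assms(2) by (subst card_Diff_singleton) auto
  then have "card (?g ` (?S - {0})) < q"
    by (rule le_less_trans[OF card_image_le[OF finite_Diff[OF fin]]])
  also have "q = card (range \<iota>)"
    using assms by (simp add: card_image)
  finally have less: "card (?g ` (?S - {0})) < card (range \<iota>)" .
  have "\<not> range \<iota> \<subseteq> ?g ` (?S - {0})"
  proof
    assume "range \<iota> \<subseteq> ?g ` (?S - {0})"
    then have "card (range \<iota>) \<le> card (?g ` (?S - {0}))"
      by (rule card_mono[OF finite_imageI[OF finite_Diff[OF fin]]])
    from leD[OF this] less show False by (rule notE)
  qed
  then obtain k where k: "\<iota> k \<notin> ?g ` (?S - {0})" by blast
  show ?thesis
  proof (rule that)
    show "\<iota> k \<noteq> s^3 - 1 / s^4" if "s \<noteq> 0" and "s^q = s" for s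
      using k that by auto
  qed
qed

lemma C_poly_smooth:
  fixes k :: "'b::field"
  assumes pp: "primepow q" and odd: "odd q" and card: "CARD('b) = q^2"
    and k_fixed: "k ^ q = k"
    and k: "\<And>s. s \<noteq> 0 \<Longrightarrow> s^q = s \<Longrightarrow> k \<noteq> s^3 - 1 / s^4"
    and P: "P \<in> curve_points (C_poly q k)"
  shows "smooth_at (C_poly q k) P"
proof -
  have q: "q > 1" using primepow_gt_Suc_0[OF pp] by simp
  have char: "(of_nat q :: 'b) = 0"
    using of_nat_prime_power_card_eq_0[OF pp card] by simp
  have two: "(2::'b) \<noteq> 0"
  proof
    assume "(2::'b) = 0"
    moreover obtain m where "q = 2 * m + 1" using odd by (rule oddE)
    ultimately have "(of_nat q :: 'b) = 1" by simp
    with char show False by simp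
  qed
  have "finite (UNIV :: 'b set)" using card q by (auto intro: card_ge_0_finite)
  then have twice: "(w ^ q) ^ q = w" for w :: 'b
    using finite_field_power_card_eq_self[of w] card
    by (simp add: power2_eq_square flip: power_mult)
  note fr = frobenius_add[OF pp card] frobenius_diff[OF pp card]
  obtain v where v: "v \<noteq> (0, 0, 0)" and Pv: "P = proj_point v"
    using P by (auto simp: curve_points_def proj_plane_def)
  obtain x y z where xyz: "v = (x, y, z)" by (cases v)
  have "v \<in> P" unfolding Pv xyz by (auto intro: exI[of _ 1])
  have "\<not> singular_at (C_poly q k) P"
  proof
    assume "singular_at (C_poly q k) P"
    with \<open>v \<in> P\<close> have
      "eval3 (C_poly q k) (x, y, z) = 0" "eval3 (dx (C_poly q k)) (x, y, z) = 0"
      "eval3 (dy (C_poly q k)) (x, y, z) = 0" "eval3 (dz (C_poly q k)) (x, y, z) = 0"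
      by (auto simp: singular_at_def xyz)
    note sing = this[unfolded gradient_C_poly[OF char] eval3_C_poly]
    \<comment> \<open>Raising the equation of the curve to the $q$-th power exchanges the point with its
      conjugate.\<close>
    have "0 = (x^2 * (x^q * y - x * y^q) + y^2 * (y^q * z - y * z^q)
     + (z^2 + k * x^2) * (z^q * x - z * x^q)) ^ q"
      using sing(1) q by simp
    also have "\<dots> = (x^q)^2 * (x * y^q - x^q * y) + (y^q)^2 * (y * z^q - y^q * z)
     + ((z^q)^2 + k * (x^q)^2) * (z * x^q - z^q * x)" (is "_ = ?conj")
      by (simp add: fr power_mult_distrib twice k_fixed power2_eq_square)
    finally have zero: "?conj = 0" by simp
    have "(x^q)^2 * (x^q * y - x * y^q) + (y^q)^2 * (y^q * z - y * z^q)
     + ((z^q)^2 + k * (x^q)^2) * (z^q * x - z * x^q) = - ?conj"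
      by (simp add: algebra_simps)
    also have "\<dots> = 0" using zero by simp
    finally have conj: "(x^q)^2 * (x^q * y - x * y^q) + (y^q)^2 * (y^q * z - y * z^q)
     + ((z^q)^2 + k * (x^q)^2) * (z^q * x - z * x^q) = 0" .
    note minors = minors_vanish_at_singular_point[OF two sing(1) conj sing(2-4)]
    have grads: "(z^2 + k * x^2) * z^q = x^2 * y^q" "x^2 * x^q = y^2 * z^q"
      "y^2 * y^q = (z^2 + k * x^2) * x^q"
      using sing(2-4) unfolding minors by simp_all
    have "q > 0" using q by simp
    from v[unfolded xyz] this minors(1,3) grads
    obtain s where "s \<noteq> 0" "s^q = s" "k = s^3 - 1 / s^4"
      by (rule rational_singular_point)
    with k show False by blast
  qed
  with P show ?thesis by (simp add: smooth_at_def)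
qed

theorem theorem1p7:
  fixes q :: nat and \<iota> :: "'a::field \<Rightarrow> 'b::field"
  assumes "primepow q" and "odd q"
    and "CARD('a) = q" and "CARD('b) = q^2" and "field_hom \<iota>"
  shows "\<exists>k::'a. plane_filling (C_poly q k) \<and>
    (\<forall>P \<in> curve_points (base_change3 \<iota> (C_poly q k)).
       smooth_at (base_change3 \<iota> (C_poly q k)) P)"
proof -
  interpret h: field_hom \<iota> by fact
  have q: "q > 1" using primepow_gt_Suc_0[OF assms(1)] by simp
  have "inj \<iota>" by (auto intro: injI)
  then obtain k where k: "\<And>s. s \<noteq> 0 \<Longrightarrow> s^q = s \<Longrightarrow> \<iota> k \<noteq> s^3 - 1 / s^4"
    using exists_parameter_avoiding_rational_singularities assms(3) q by metis
  have "finite (UNIV :: 'a set)" using assms(3) q by (auto intro: card_ge_0_finite)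
  then have "k ^ q = k"
    using finite_field_power_card_eq_self[of k] assms(3) by simp
  then have "\<iota> k ^ q = \<iota> k" by (metis h.hom_power)
  then show ?thesis
    using plane_filling_C_poly[OF assms(1,3)] C_poly_smooth[OF assms(1,2,4) _ k]
      base_change3_C_poly[OF assms(5)] by metis
qed

end
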